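(* Let $P_X$ be a probability measure on $[0,1]^d$ that has a density bounded below by a constant $C_{P_X}>0$ on $[0,1]^d$, and let $f^*:[0,1]^d\to\mathbb{R}$ be continuous. Then there is a constant $C_{P_X,p,d}>0$, depending only on $P_X,p,d$, such that for any bounded and continuous $f:[0,1]^d\to\mathbb{R}$, $$\|f-f^*\|_{P_X,\Delta}^2\ \ge\ C_{P_X,p,d}\,h^d\,\|f-f^*\|_{L^\infty}^2 .$$
   Context: $d\in\mathbb{N}$, $p\in[1,\infty]$, $h\in(0,1)$. $\Delta_h^p(x)=\{x'\in[0,1]^d:\|x-x'\|_p\le h\}$. The adversarial (pseudo-)norm is $\|g\|_{P_X,\Delta}^2=\mathbb{E}_{X\sim P_X}\big[\max_{x'\in\Delta_h^p(X)}|g(x')|^2\big]$, and $\|g\|_{L^\infty}=\sup_{x\in[0,1]^d}|g(x)|$. *)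

theory Defs
  imports "HOL-Probability.Probability"
begin

(* 1 :: real ^ 'n is the all-ones vector. *)
abbreviation unit_cube :: "(real ^ 'n) set" where
  "unit_cube \<equiv> cbox 0 1"

definition lp_norm :: "ennreal \<Rightarrow> real ^ 'n \<Rightarrow> real" where
  "lp_norm p x =
    (if p = \<infinity> then infnorm x
     else (\<Sum>i\<in>UNIV. \<bar>x $ i\<bar> powr enn2real p) powr (1 / enn2real p))"

definition perturbation :: "ennreal \<Rightarrow> real \<Rightarrow> real ^ 'n \<Rightarrow> (real ^ 'n) set" where
  "perturbation p h x = {x' \<in> unit_cube. lp_norm p (x - x') \<le> h}"

(* For g continuous on the cube and x in the cube, the supremum ranges over a nonempty
   compact set, so it is a maximum. *)
definition adv_norm :: "(real ^ 'n) measure \<Rightarrow> ennreal \<Rightarrow> real \<Rightarrow> (real ^ 'n \<Rightarrow> real) \<Rightarrow> real" where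
  "adv_norm P p h g =
    sqrt (prob_space.expectation P (\<lambda>x. SUP x'\<in>perturbation p h x. \<bar>g x'\<bar>\<^sup>2))"

definition linf_norm :: "(real ^ 'n \<Rightarrow> real) \<Rightarrow> real" where
  "linf_norm g = (SUP x\<in>unit_cube. \<bar>g x\<bar>)"

(* The space of P is the cube itself, not all of the Euclidean space. *)
definition has_cube_density :: "(real ^ 'n) measure \<Rightarrow> (real ^ 'n \<Rightarrow> real) \<Rightarrow> bool" where
  "has_cube_density P \<rho> \<longleftrightarrow>
    \<rho> \<in> borel_measurable (restrict_space lborel unit_cube) \<and>
    (\<forall>x\<in>unit_cube. 0 \<le> \<rho> x) \<and>
    P = density (restrict_space lborel unit_cube) (\<lambda>x. ennreal (\<rho> x))"

end

theory Submission
  imports Defs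
begin

text \<open>
  Let \<open>n\<close> be the dimension, \<open>c\<close> the lower bound of the density, and let \<open>x0\<close> maximise
  \<open>\<bar>f - fstar\<bar>\<close> on the cube. The cube contains an axis-parallel box of side \<open>h / n\<close> around \<open>x0\<close>
  (not necessarily centred at it), and each of its points has \<open>x0\<close> in its perturbation set,
  because \<open>n powr (1 / p) * (h / n) \<le> h\<close>. The box has probability at least \<open>c * (h / n) ^ n\<close>,
  so \<open>C = c / n ^ n\<close> works. The integrand is measurable since it is upper semicontinuous: its
  superlevel sets on the cube are projections of compact sets.
\<close>

section \<open>Continuity and size of \<open>lp_norm\<close>\<close>

lemma enn2real_ge_1:
  assumes "1 \<le> p" "p \<noteq> \<infinity>"
  shows "1 \<le> enn2real p"
  using assms enn2real_mono[of 1 p] by (simp add: less_top)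

lemma continuous_on_lp_norm:
  fixes A :: "(real ^ 'n) set"
  assumes "1 \<le> p"
  shows "continuous_on A (lp_norm p)"
proof (cases "p = \<infinity>")
  case True
  then have "lp_norm p = (infnorm :: real ^ 'n \<Rightarrow> real)"
    by (simp add: lp_norm_def fun_eq_iff)
  then show ?thesis
    using continuous_on_infnorm[OF continuous_on_id, of A] by simp
next
  case False
  have q: "1 \<le> enn2real p"
    using enn2real_ge_1[OF assms False] .
  have "continuous_on A
      (\<lambda>x :: real ^ 'n. (\<Sum>i\<in>UNIV. \<bar>x $ i\<bar> powr enn2real p) powr (1 / enn2real p))"
    \<comment> \<open>At a base of 0, \<open>powr\<close> is continuous only if the exponent stays
      positive; \<open>q\<close> ensures this for both \<open>enn2real p\<close> and its
      reciprocal.\<close>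
    using q by (intro continuous_on_powr' continuous_intros) (auto intro: sum_nonneg)
  then show ?thesis
    using False by (simp add: lp_norm_def[abs_def])
qed

lemma lp_norm_zero: "1 \<le> p \<Longrightarrow> lp_norm p 0 = 0"
  by (auto simp: lp_norm_def infnorm_0)

text \<open>The sharp factor is the dimension to the power 1/p. Since the dimension is at least 1
  and 1/p is at most 1, it is relaxed to the dimension itself, which gives one bound for all p,
  including infinity.\<close>

lemma lp_norm_le_component_bound:
  fixes x :: "real ^ 'n" and t :: real
  assumes "1 \<le> p" and "0 \<le> t" and t: "\<And>i. \<bar>x $ i\<bar> \<le> t"
  shows "lp_norm p x \<le> CARD('n) * t"
proof (cases "p = \<infinity>")
  case True
  have "infnorm x \<le> t"
    unfolding infnorm_Max using t by (auto simp: Basis_vec_def inner_axis)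
  also have "\<dots> \<le> CARD('n) * t"
    using mult_right_mono[of 1 "real CARD('n)" t] \<open>0 \<le> t\<close> by simp
  finally show ?thesis
    using True by (simp add: lp_norm_def)
next
  case False
  define q where "q = enn2real p"
  have q: "1 \<le> q"
    unfolding q_def using enn2real_ge_1[OF assms(1) False] .
  have "(\<Sum>i\<in>UNIV. \<bar>x $ i\<bar> powr q) \<le> (\<Sum>i\<in>(UNIV :: 'n set). t powr q)"
    using t q by (intro sum_mono powr_mono2) auto
  also have "\<dots> = CARD('n) * t powr q"
    by simp
  finally have "(\<Sum>i\<in>UNIV. \<bar>x $ i\<bar> powr q) powr (1 / q) \<le> (CARD('n) * t powr q) powr (1 / q)"
    using q by (intro powr_mono2) (auto intro: sum_nonneg)
  also have "\<dots> = CARD('n) powr (1 / q) * t"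
    using q \<open>0 \<le> t\<close> by (simp add: powr_mult powr_powr)
  also have "\<dots> \<le> CARD('n) powr 1 * t"
    using q \<open>0 \<le> t\<close> by (intro mult_right_mono powr_mono) auto
  finally show ?thesis
    using False by (simp add: lp_norm_def q_def)
qed

lemma mem_perturbation_self:
  assumes "1 \<le> p" "0 \<le> h" "x \<in> unit_cube"
  shows "x \<in> perturbation p h x"
  using assms by (simp add: perturbation_def lp_norm_zero)

section \<open>Compactness of perturbation sets and semicontinuity of the supremum over them\<close>

lemma compact_perturbation_graph:
  assumes "1 \<le> p"
  shows "compact {z \<in> unit_cube \<times> unit_cube. lp_norm p (fst z - snd z) \<le> h}"
proof -
  have cont: "continuous_on UNIV (\<lambda>z :: (real ^ 'n) \<times> (real ^ 'n). lp_norm p (fst z - snd z))"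
    by (intro continuous_on_compose2[OF continuous_on_lp_norm[OF assms, of UNIV]]
        continuous_intros) auto
  have "compact (unit_cube \<times> unit_cube \<inter>
      {z :: (real ^ 'n) \<times> (real ^ 'n). lp_norm p (fst z - snd z) \<le> h})"
    by (intro compact_Int_closed compact_Times compact_cbox closed_Collect_le cont continuous_intros)
  then show ?thesis
    by (simp add: Int_def)
qed

lemma compact_perturbation:
  assumes "1 \<le> p"
  shows "compact (perturbation p h x)"
proof -
  have cont: "continuous_on UNIV (\<lambda>x'. lp_norm p (x - x'))"
    by (intro continuous_on_compose2[OF continuous_on_lp_norm[OF assms, of UNIV]]
        continuous_intros) auto
  have "compact (unit_cube \<inter> {x'. lp_norm p (x - x') \<le> h})"
    by (intro compact_Int_closed compact_cbox closed_Collect_le cont continuous_intros)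
  then show ?thesis
    by (simp add: perturbation_def Int_def)
qed

text \<open>The supremum is attained, so it is at least \<open>a\<close> exactly when some
  admissible x' has \<open>a \<le> G x'\<close>. The superlevel set is therefore the first
  projection of a closed part of the compact perturbation graph.\<close>

lemma compact_superlevel_perturbation_SUP:
  fixes G :: "real ^ 'n \<Rightarrow> real"
  assumes p: "1 \<le> p" and h: "0 \<le> h" and G: "continuous_on unit_cube G"
  shows "compact {x \<in> unit_cube. a \<le> (SUP x'\<in>perturbation p h x. G x')}"
proof -
  let ?S = "{z \<in> unit_cube \<times> unit_cube. lp_norm p (fst z - snd z) \<le> h} :: ((real ^ 'n) \<times> _) set"
  let ?T = "{z \<in> ?S. a \<le> G (snd z)}"
  have cont: "continuous_on ?S (\<lambda>z. G (snd z))"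
    by (intro continuous_on_compose2[OF G] continuous_intros) auto
  \<comment> \<open>\<open>G\<close> is continuous on the cube only, so the preimage is a priori
    closed relative to \<open>?S\<close>; closedness of \<open>?S\<close> makes it closed in the
    whole space.\<close>
  have "closed ?S"
    by (intro compact_imp_closed compact_perturbation_graph[OF p])
  from continuous_closed_preimage[OF cont this closed_atLeast[of a]] have "closed ?T"
    by (simp add: Int_def)
  then have "compact (?S \<inter> ?T)"
    by (intro compact_Int_closed compact_perturbation_graph[OF p])
  then have "compact (fst ` (?S \<inter> ?T))"
    by (intro compact_continuous_image continuous_intros)
  moreover have "fst ` (?S \<inter> ?T) = {x \<in> unit_cube. a \<le> (SUP x'\<in>perturbation p h x. G x')}"
  proof (intro set_eqI iffI)
    fix x assume "x \<in> fst ` (?S \<inter> ?T)"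
    then obtain x' where x: "x \<in> unit_cube" and x': "x' \<in> perturbation p h x" "a \<le> G x'"
      by (auto simp: perturbation_def)
    \<comment> \<open>A real \<open>SUP\<close> dominates the values only when they are bounded
      above; compactness provides that.\<close>
    have "continuous_on (perturbation p h x) G"
      by (rule continuous_on_subset[OF G]) (auto simp: perturbation_def)
    then have "bdd_above (G ` perturbation p h x)"
      by (intro bounded_imp_bdd_above compact_imp_bounded compact_continuous_image
          compact_perturbation[OF p])
    from cSUP_upper2[OF this x'] show "x \<in> {x \<in> unit_cube. a \<le> (SUP x'\<in>perturbation p h x. G x')}"
      using x by simp
  next
    fix x assume "x \<in> {x \<in> unit_cube. a \<le> (SUP x'\<in>perturbation p h x. G x')}"
    then have x: "x \<in> unit_cube" and le: "a \<le> (SUP x'\<in>perturbation p h x. G x')"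
      by auto
    have ne: "perturbation p h x \<noteq> {}"
      using mem_perturbation_self[OF p h x] by auto
    have "continuous_on (perturbation p h x) G"
      by (rule continuous_on_subset[OF G]) (auto simp: perturbation_def)
    from continuous_attains_sup[OF compact_perturbation[OF p] ne this]
    obtain x' where x': "x' \<in> perturbation p h x" "\<And>y. y \<in> perturbation p h x \<Longrightarrow> G y \<le> G x'"
      by auto
    have "(SUP x'\<in>perturbation p h x. G x') \<le> G x'"
      using x'(2) ne by (intro cSUP_least)
    then have "(x, x') \<in> ?S \<inter> ?T"
      using x x'(1) le by (auto simp: perturbation_def)
    then show "x \<in> fst ` (?S \<inter> ?T)"
      by force
  qed
  ultimately show ?thesis
    by simp
qed

section \<open>A box of prescribed side inside the cube, and its probability\<close>

lemma obtain_box_around_point: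
  fixes x0 :: "real ^ 'n"
  assumes "x0 \<in> unit_cube" and "0 \<le> s" and "s \<le> 1"
  obtains a b where "cbox a b \<subseteq> unit_cube" "x0 \<in> cbox a b"
    "\<And>x i. x \<in> cbox a b \<Longrightarrow> \<bar>x $ i - x0 $ i\<bar> \<le> s"
    "measure lborel (cbox a b) = s ^ CARD('n)"
proof
  \<comment> \<open>In each coordinate the interval starts at that of \<open>x0\<close>, unless it
    would then pass 1; in that case it is shifted back to end at 1. Either way it contains the
    coordinate of \<open>x0\<close>.\<close>
  let ?a = "\<chi> i. min (x0 $ i) (1 - s)"
  let ?b = "\<chi> i. min (x0 $ i) (1 - s) + s"
  have x0: "0 \<le> x0 $ i" "x0 $ i \<le> 1" for i
    using assms(1) by (auto simp: mem_box_cart)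
  show "cbox ?a ?b \<subseteq> unit_cube"
  proof
    fix x assume "x \<in> cbox ?a ?b"
    then have "min (x0 $ i) (1 - s) \<le> x $ i \<and> x $ i \<le> min (x0 $ i) (1 - s) + s" for i
      by (simp add: mem_box_cart)
    then have "0 \<le> x $ i \<and> x $ i \<le> 1" for i
      using x0[of i] assms(2,3) by (smt (verit))
    then show "x \<in> unit_cube"
      by (simp add: mem_box_cart)
  qed
  show mem: "x0 \<in> cbox ?a ?b"
    using x0 assms(2,3) by (auto simp: mem_box_cart min_def)
  show "\<bar>x $ i - x0 $ i\<bar> \<le> s" if "x \<in> cbox ?a ?b" for x i
  proof -
    have "min (x0 $ i) (1 - s) \<le> x $ i \<and> x $ i \<le> min (x0 $ i) (1 - s) + s"
      using that by (simp add: mem_box_cart)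
    then show ?thesis
      using x0[of i] assms(2,3) by (smt (verit))
  qed
  \<comment> \<open>\<open>mem\<close> shows that the box is nonempty, which the product formula for
    its volume requires.\<close>
  show "measure lborel (cbox ?a ?b) = s ^ CARD('n)"
    using mem by (subst content_cbox_if_cart) auto
qed

lemma has_cube_density_emeasure_ge:
  fixes P :: "(real ^ 'n) measure"
  assumes P: "has_cube_density P \<rho>" and c: "\<And>x. x \<in> unit_cube \<Longrightarrow> c \<le> \<rho> x"
    and B: "B \<in> sets borel" "B \<subseteq> unit_cube"
  shows "ennreal c * emeasure lborel B \<le> emeasure P B"
proof -
  let ?M = "restrict_space lborel unit_cube :: (real ^ 'n) measure"
  have BM: "B \<in> sets ?M"
    using B by (subst sets_restrict_space_iff) auto
  have "ennreal c * emeasure lborel B = ennreal c * emeasure ?M B"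
    using B by (subst emeasure_restrict_space) auto
  also have "\<dots> = (\<integral>\<^sup>+x. ennreal c * indicator B x \<partial>?M)"
    using BM by (simp add: nn_integral_cmult_indicator)
  also have "\<dots> \<le> (\<integral>\<^sup>+x. ennreal (\<rho> x) * indicator B x \<partial>?M)"
    using c by (intro nn_integral_mono mult_right_mono ennreal_leI)
      (auto simp: space_restrict_space)
  also have "\<dots> = emeasure P B"
    using P BM by (auto simp: has_cube_density_def emeasure_density)
  finally show ?thesis .
qed

lemma has_cube_density_space_sets:
  fixes P :: "(real ^ 'n) measure"
  assumes "has_cube_density P \<rho>"
  shows "space P = unit_cube" and "B \<in> sets borel \<Longrightarrow> B \<subseteq> unit_cube \<Longrightarrow> B \<in> sets P"
proof -
  have P: "P = density (restrict_space lborel unit_cube) (\<lambda>x. ennreal (\<rho> x))"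
    using assms by (simp add: has_cube_density_def)
  show "space P = unit_cube"
    by (subst P) (simp add: space_restrict_space)
  show "B \<in> sets P" if "B \<in> sets borel" "B \<subseteq> unit_cube"
    using that by (subst P) (simp add: sets_restrict_space_iff)
qed

section \<open>The lower bound for the adversarial norm\<close>

lemma adv_norm_sq_ge:
  fixes P :: "(real ^ 'n) measure" and g :: "real ^ 'n \<Rightarrow> real"
  assumes p: "1 \<le> p" and "prob_space P"
    and P: "has_cube_density P \<rho>" and "0 < c" and c: "\<And>x. x \<in> unit_cube \<Longrightarrow> c \<le> \<rho> x"
    and h: "0 < h" "h \<le> 1" and g: "continuous_on unit_cube g"
  shows "c / real CARD('n) ^ CARD('n) * h ^ CARD('n) * (linf_norm g)\<^sup>2 \<le> (adv_norm P p h g)\<^sup>2"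
proof -
  interpret prob_space P by fact
  let ?n = "CARD('n)"
  let ?F = "\<lambda>x. SUP x'\<in>perturbation p h x. \<bar>g x'\<bar>\<^sup>2"
  note space = has_cube_density_space_sets(1)[OF P] and sets = has_cube_density_space_sets(2)[OF P]
  have G: "continuous_on unit_cube (\<lambda>x. \<bar>g x\<bar>\<^sup>2)"
    using g by (intro continuous_intros)
  have "(0 :: real ^ 'n) \<in> unit_cube"
    by (simp add: mem_box_cart)
  then have ne: "(unit_cube :: (real ^ 'n) set) \<noteq> {}"
    by blast
  have "continuous_on unit_cube (\<lambda>x. \<bar>g x\<bar>)"
    using g by (intro continuous_intros)
  from continuous_attains_sup[OF compact_cbox ne this]
  obtain x0 where x0: "x0 \<in> unit_cube" and max: "\<And>x. x \<in> unit_cube \<Longrightarrow> \<bar>g x\<bar> \<le> \<bar>g x0\<bar>"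
    by auto
  have linf: "linf_norm g = \<bar>g x0\<bar>"
    unfolding linf_norm_def using x0 max by (intro cSup_eq_maximum) auto
  have bound: "\<bar>g x'\<bar>\<^sup>2 \<le> \<bar>g x0\<bar>\<^sup>2" if "x' \<in> perturbation p h x" for x x'
    using that max[of x'] by (intro power_mono) (auto simp: perturbation_def)
  have bdd: "bdd_above ((\<lambda>x'. \<bar>g x'\<bar>\<^sup>2) ` perturbation p h x)" for x
    using bound by (intro bdd_aboveI2)
  have self: "x \<in> perturbation p h x" if "x \<in> unit_cube" for x
    using mem_perturbation_self[OF p _ that] h by simp
  have F_nonneg: "0 \<le> ?F x" if "x \<in> unit_cube" for x
    by (rule cSUP_upper2[OF bdd self[OF that]]) simp
  have F_le: "?F x \<le> \<bar>g x0\<bar>\<^sup>2" if "x \<in> unit_cube" for x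
    using self[OF that] bound by (intro cSUP_least) auto
  \<comment> \<open>The space of \<open>P\<close> is the cube itself, so the sets to be measured are
    exactly the compact superlevel sets.\<close>
  have F_meas: "?F \<in> borel_measurable P"
    unfolding borel_measurable_iff_ge space
    using h by (intro allI sets borel_compact compact_superlevel_perturbation_SUP[OF p _ G]) auto
  \<comment> \<open>Without integrability the expectation would take the default value 0 and could
    not be compared from below.\<close>
  have F_int: "integrable P ?F"
    using F_nonneg F_le
    by (intro integrable_const_bound[of _ "\<bar>g x0\<bar>\<^sup>2"] F_meas AE_I2) (auto simp: space)
  have "h \<le> real ?n"
    using h(2) by (rule order_trans) (simp add: Suc_leI)
  then have s: "0 \<le> h / ?n" "h / ?n \<le> 1"
    using h by auto
  from obtain_box_around_point[OF x0 s] obtain a b where B: "cbox a b \<subseteq> unit_cube"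
    and near: "\<And>x i. x \<in> cbox a b \<Longrightarrow> \<bar>x $ i - x0 $ i\<bar> \<le> h / ?n"
    and vol: "measure lborel (cbox a b) = (h / ?n) ^ ?n"
    by metis
  have B_sets: "cbox a b \<in> sets P"
    using B by (intro sets) auto
  have "ennreal (c * (h / ?n) ^ ?n) = ennreal c * emeasure lborel (cbox a b)"
    using \<open>0 < c\<close> s vol emeasure_lborel_cbox_finite[of a b]
    by (subst emeasure_eq_ennreal_measure) (auto simp: ennreal_mult)
  also have "\<dots> \<le> emeasure P (cbox a b)"
    using B by (intro has_cube_density_emeasure_ge[OF P c]) auto
  finally have PB: "c * (h / ?n) ^ ?n \<le> prob (cbox a b)"
    by (simp add: emeasure_eq_measure)
  \<comment> \<open>The roles are reversed here: every x in the box can be perturbed to the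
    maximiser \<open>x0\<close>. The side \<open>h / ?n\<close> is chosen so that the factor
    \<open>?n\<close> of the norm bound cancels.\<close>
  have in_pert: "x0 \<in> perturbation p h x" if "x \<in> cbox a b" for x
    using lp_norm_le_component_bound[OF p s(1), of "x - x0"] near[OF that] x0
    by (auto simp: perturbation_def)
  have "c / real ?n ^ ?n * h ^ ?n * (linf_norm g)\<^sup>2 = c * (h / ?n) ^ ?n * \<bar>g x0\<bar>\<^sup>2"
    by (simp add: linf power_divide)
  also have "\<dots> \<le> prob (cbox a b) * \<bar>g x0\<bar>\<^sup>2"
    using PB by (intro mult_right_mono) auto
  also have "\<dots> = expectation (\<lambda>x. indicator (cbox a b) x * \<bar>g x0\<bar>\<^sup>2)"
    using B_sets by simp
  \<comment> \<open>On the box \<open>?F\<close> is at least the value at \<open>x0\<close>; off the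
    box only its nonnegativity is used.\<close>
  also have "\<dots> \<le> expectation ?F"
  proof (rule integral_mono[OF _ F_int])
    show "integrable P (\<lambda>x. indicator (cbox a b) x * \<bar>g x0\<bar>\<^sup>2)"
      using B_sets by (intro integrable_mult_left integrable_real_indicator)
        (auto simp: less_top[symmetric])
    show "indicator (cbox a b) x * \<bar>g x0\<bar>\<^sup>2 \<le> ?F x" if "x \<in> space P" for x
    proof (cases "x \<in> cbox a b")
      case True
      then show ?thesis
        using cSUP_upper[OF in_pert[OF True] bdd] by simp
    next
      case False
      then show ?thesis
        using F_nonneg that by (simp add: space)
    qed
  qed
  also have "expectation ?F = (adv_norm P p h g)\<^sup>2"
    unfolding adv_norm_def using F_nonneg
    by (subst real_sqrt_pow2) (auto intro!: Bochner_Integration.integral_nonneg simp: space)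
  finally show ?thesis .
qed

theorem lemma9:
  fixes P :: "(real ^ 'n) measure" and p :: ennreal
  assumes "1 \<le> p"
    and "prob_space P"
    and "\<exists>\<rho> c. has_cube_density P \<rho> \<and> c > 0 \<and> (\<forall>x\<in>unit_cube. c \<le> \<rho> x)"
  shows "\<exists>C::real. C > 0 \<and>
    (\<forall>(h::real) (fstar :: real ^ 'n \<Rightarrow> real) (f :: real ^ 'n \<Rightarrow> real).
       0 < h \<longrightarrow> h < 1 \<longrightarrow>
       continuous_on unit_cube fstar \<longrightarrow>
       continuous_on unit_cube f \<longrightarrow> bounded (f ` unit_cube) \<longrightarrow>
       (adv_norm P p h (\<lambda>x. f x - fstar x))\<^sup>2
         \<ge> C * h ^ CARD('n) * (linf_norm (\<lambda>x. f x - fstar x))\<^sup>2)"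
proof -
  obtain \<rho> c where P: "has_cube_density P \<rho>" and c: "c > 0" "\<And>x. x \<in> unit_cube \<Longrightarrow> c \<le> \<rho> x"
    using assms(3) by auto
  \<comment> \<open>The witness involves only the density bound and the dimension, so it is fixed
    before \<open>h\<close>, \<open>fstar\<close> and \<open>f\<close>.\<close>
  show ?thesis
    using c(1)
    by (intro exI[of _ "c / real CARD('n) ^ CARD('n)"] conjI allI impI
        adv_norm_sq_ge[OF assms(1,2) P c] continuous_on_diff) auto
qed

end
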